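(* For each integer $d \geq 1$, let $B_{2,d}\subset\mathbb{R}^d$ be an $\ell_2$ ball of positive radius and let $B_{\infty,d}\subset\mathbb{R}^d$ be an $\ell_\infty$ ball of positive radius, both centered at the same point (the center and the radii may depend on $d$). Suppose that for every $d$ the two balls have the same volume, i.e. $\operatorname{Vol}(B_{2,d})=\operatorname{Vol}(B_{\infty,d})$. Then $$\frac{\operatorname{Vol}(B_{2,d}\cap B_{\infty,d})}{\operatorname{Vol}(B_{\infty,d})}\longrightarrow 0 \quad\text{as } d\to\infty.$$
   Context: For $p\in\{2,\infty\}$, the $\ell_p$ ball in $\mathbb{R}^d$ with center $x\in\mathbb{R}^d$ and radius $\epsilon>0$ is $\{x+\tau : \tau\in\mathbb{R}^d,\ \|\tau\|_p\leq \epsilon\}$, where $\|\tau\|_2=(\sum_{i=1}^d|\tau_i|^2)^{1/2}$ and $\|\tau\|_\infty=\max_{1\le i\le d}|\tau_i|$. $\operatorname{Vol}$ denotes $d$-dimensional Lebesgue measure. *)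

theory Defs
  imports "HOL-Analysis.Analysis"
begin

(* A vector of R^d is a function on {..<d}, extended by undefined outside {..<d}; this is the
   space of the product measure below, so d can be quantified over. *)
definition Rspace :: "nat \<Rightarrow> (nat \<Rightarrow> real) set" where
  "Rspace d = {..<d} \<rightarrow>\<^sub>E UNIV"

definition Vol :: "nat \<Rightarrow> (nat \<Rightarrow> real) set \<Rightarrow> real" where
  "Vol d = measure (completion (\<Pi>\<^sub>M i\<in>{..<d}. (lborel :: real measure)))"

(* The maximum is over a nonempty set only for d >= 1. *)
definition linf_norm :: "nat \<Rightarrow> (nat \<Rightarrow> real) \<Rightarrow> real" where
  "linf_norm d x = Max ((\<lambda>i. \<bar>x i\<bar>) ` {..<d})"

definition l2_ball :: "nat \<Rightarrow> (nat \<Rightarrow> real) \<Rightarrow> real \<Rightarrow> (nat \<Rightarrow> real) set" where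
  "l2_ball d x \<epsilon> = {\<lambda>i\<in>{..<d}. x i + \<tau> i | \<tau>. \<tau> \<in> Rspace d \<and> L2_set \<tau> {..<d} \<le> \<epsilon>}"

definition linf_ball :: "nat \<Rightarrow> (nat \<Rightarrow> real) \<Rightarrow> real \<Rightarrow> (nat \<Rightarrow> real) set" where
  "linf_ball d x \<epsilon> = {\<lambda>i\<in>{..<d}. x i + \<tau> i | \<tau>. \<tau> \<in> Rspace d \<and> linf_norm d \<tau> \<le> \<epsilon>}"

(* Both balls are Borel, so Vol is never applied to a set outside its sigma-algebra (where the
   library's measure is 0 by convention). *)

lemma translate_Rspace:
  "{\<lambda>i\<in>{..<d}. x i + \<tau> i | \<tau>. \<tau> \<in> Rspace d \<and> P \<tau>} =
   {y \<in> Rspace d. P (\<lambda>i\<in>{..<d}. y i - x i)}"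
proof (intro set_eqI iffI)
  fix y assume "y \<in> {\<lambda>i\<in>{..<d}. x i + \<tau> i | \<tau>. \<tau> \<in> Rspace d \<and> P \<tau>}"
  then obtain t where t: "y = (\<lambda>i\<in>{..<d}. x i + t i)" "t \<in> Rspace d" "P t"
    by blast
  have "(\<lambda>i\<in>{..<d}. y i - x i) = t"
    using t(1,2) by (auto simp: Rspace_def fun_eq_iff PiE_def extensional_def)
  then show "y \<in> {y \<in> Rspace d. P (\<lambda>i\<in>{..<d}. y i - x i)}"
    using t by (auto simp: Rspace_def)
next
  fix y assume y: "y \<in> {y \<in> Rspace d. P (\<lambda>i\<in>{..<d}. y i - x i)}"
  define t where "t = (\<lambda>i\<in>{..<d}. y i - x i)"
  have "y = (\<lambda>i\<in>{..<d}. x i + t i)"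
    using y by (auto simp: t_def Rspace_def fun_eq_iff PiE_def extensional_def)
  moreover have "t \<in> Rspace d" "P t"
    using y by (auto simp: t_def Rspace_def)
  ultimately show "y \<in> {\<lambda>i\<in>{..<d}. x i + \<tau> i | \<tau>. \<tau> \<in> Rspace d \<and> P \<tau>}"
    by blast
qed

lemma l2_ball_sets: "l2_ball d x \<epsilon> \<in> sets (\<Pi>\<^sub>M i\<in>{..<d}. (lborel :: real measure))"
proof -
  let ?M = "\<Pi>\<^sub>M i\<in>{..<d}. (lborel :: real measure)"
  have "l2_ball d x \<epsilon> = {y \<in> space ?M. sqrt (\<Sum>i<d. (y i - x i)\<^sup>2) \<le> \<epsilon>}"
    unfolding l2_ball_def translate_Rspace by (simp add: L2_set_def Rspace_def space_PiM)
  also have "\<dots> \<in> sets ?M"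
    by measurable
  finally show ?thesis .
qed

lemma linf_ball_sets:
  assumes "d \<ge> 1"
  shows "linf_ball d x \<epsilon> \<in> sets (\<Pi>\<^sub>M i\<in>{..<d}. (lborel :: real measure))"
proof -
  let ?M = "\<Pi>\<^sub>M i\<in>{..<d}. (lborel :: real measure)"
  have "linf_ball d x \<epsilon> = {y \<in> space ?M. \<forall>i\<in>{..<d}. \<bar>y i - x i\<bar> \<le> \<epsilon>}"
    unfolding linf_ball_def translate_Rspace linf_norm_def using assms
    by (subst Max_le_iff) (auto simp: Rspace_def space_PiM lessThan_empty_iff)
  also have "\<dots> \<in> sets ?M"
    by measurable
  finally show ?thesis .
qed

end

theory Submission
  imports Defs
begin

text \<open>
  By Stirling, equality of the volumes forces \<open>r\<^sup>2 \<sim> 2 / (\<pi> e) \<cdot> d s\<^sup>2\<close>, whereas a uniform random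
  point of the cube has squared distance about \<open>d s\<^sup>2 / 3\<close> from the centre. As
  \<open>2 / (\<pi> e) < 3 / 10 < 1 / 3\<close>, eventually \<open>r\<^sup>2 \<le> 3 / 10 \<cdot> d s\<^sup>2\<close>, and Chernoff's bound shows that
  the intersection is an exponentially small part of the cube.
\<close>

section \<open>Volume of the Euclidean ball: a Stirling-type estimate\<close>

text \<open>In the Gamma integral, bound \<open>t\<^sup>x exp (- l t)\<close> by its maximum, attained at \<open>t = x / l\<close>.
  Compared with Stirling's formula this only costs \<open>l\<close> in the base, which may be taken close to 1.\<close>

lemma Gamma_plus1_real_upper_bound:
  fixes x l :: real
  assumes x: "x > 0" and l: "0 < l" "l < 1"
  shows "Gamma (x + 1) \<le> (x / l) powr x * exp (- x) / (1 - l)"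
proof -
  have "((\<lambda>t. t powr x / exp t) has_integral Gamma (x + 1)) {0..}"
    using Gamma_integral_real[of "x + 1"] x by simp
  moreover have "((\<lambda>t. (x / l) powr x * exp (- x) * exp (- (1 - l) * t)) has_integral
      (x / l) powr x * exp (- x) * (exp (- (1 - l) * 0) / (1 - l))) {0..}"
    using has_integral_exp_minus_to_infinity[of "1 - l" 0] l
    by (intro has_integral_mult_right) auto
  moreover have "t powr x / exp t \<le> (x / l) powr x * exp (- x) * exp (- (1 - l) * t)"
    if "t \<in> {0..}" for t
  proof -
    have t: "t \<ge> 0" using that by simp
    \<comment> \<open>This is \<open>1 + u \<le> exp u\<close> at \<open>u = l * t / x - 1\<close>,
      with equality at the maximum point \<open>t = x / l\<close>. Raising it to the power
      \<open>x\<close> gives the pointwise bound.\<close>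
    have "l * t / x \<le> exp (l * t / x - 1)"
      using exp_ge_add_one_self[of "l * t / x - 1"] by simp
    then have "x / l * (l * t / x) \<le> x / l * exp (l * t / x - 1)"
      using x l by (intro mult_left_mono) auto
    then have "t \<le> x / l * exp (l * t / x - 1)"
      using x l by simp
    then have "t powr x \<le> (x / l * exp (l * t / x - 1)) powr x"
      using t x by (intro powr_mono2) auto
    also have "\<dots> = (x / l) powr x * exp (l * t - x)"
      using x l by (subst powr_mult) (simp_all add: exp_powr_real left_diff_distrib)
    finally have "t powr x / exp t \<le> (x / l) powr x * exp (l * t - x) / exp t"
      by (rule divide_right_mono) auto
    also have "\<dots> = (x / l) powr x * exp (- x) * exp (- (1 - l) * t)"
      by (simp add: field_simps flip: exp_add exp_diff)
    finally show ?thesis .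
  qed
  ultimately have "Gamma (x + 1) \<le> (x / l) powr x * exp (- x) * (exp (- (1 - l) * 0) / (1 - l))"
    by (rule has_integral_le)
  then show ?thesis by simp
qed

text \<open>With both sides scaled by \<open>s ^ d\<close>, this says that a Euclidean ball of
  squared radius \<open>3 / 10 * d * s\<^sup>2\<close> eventually has more volume than the cube of
  side \<open>2 * s\<close>, so equal volumes force a smaller Euclidean radius.\<close>

lemma eventually_unit_ball_vol_gt:
  "eventually (\<lambda>d. 2 ^ d < unit_ball_vol (real d) * sqrt (3 / 10 * real d) ^ d) sequentially"
proof -
  \<comment> \<open>The Gamma bound with \<open>l = 9 / 10\<close> loses the factor
    \<open>1 / (1 - 9 / 10) = 10\<close>. The gap between the bases \<open>9 / 2\<close> and 4, a
    ratio of \<open>9 / 8\<close>, absorbs it for large \<open>d\<close>.\<close>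
  obtain n :: nat where n: "10 < sqrt (9 / 8) ^ n"
    using real_arch_pow[of "sqrt (9 / 8)" 10] by auto
  then have "10 < sqrt (9 / 8) ^ d" if "d \<ge> n" for d
    using power_increasing[OF that, of "sqrt (9 / 8)"] n by (auto intro: less_le_trans)
  then have "eventually (\<lambda>d. 10 < sqrt (9 / 8) ^ d) sequentially"
    by (rule eventually_sequentiallyI)
  with eventually_gt_at_top[of 0] show ?thesis
  proof eventually_elim
    case (elim d)
    define x where "x = real d / 2"
    have x: "x > 0" using elim by (simp add: x_def)
    have sq: "sqrt a ^ d = a powr x" if "a > 0" for a
      using that powr_realpow[of "sqrt a" d] by (simp add: x_def powr_half_sqrt[symmetric] powr_powr)
    have "27 / 10 \<le> exp (1 :: real)"
      using e_approx_32 unfolding abs_diff_le_iff by simp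
    then have "31 / 10 * (27 / 10) \<le> pi * exp (1 :: real)"
      using pi_approx(1) by (intro mult_mono) simp_all
    \<comment> \<open>Here \<open>27 / 50 = 6 / 10 * (9 / 10)\<close>: the first factor comes from
      \<open>3 / 10 * d = 6 / 10 * x\<close>, the second is \<open>l\<close>.\<close>
    then have base: "9 / 2 \<le> 27 / 50 * pi * exp 1" by simp
    have G: "0 < Gamma (x + 1)" using x by (simp add: Gamma_real_pos)
    have "2 ^ d = 4 powr x"
      using sq[of 4] by simp
    also have "\<dots> < 4 powr x * ((9 / 8) powr x / 10)"
      using elim sq[of "9/8"] by simp
    also have "\<dots> = (9 / 2) powr x / 10"
      using powr_mult[of 4 "9 / 8" x] by simp
    also have "\<dots> \<le> (27 / 50 * pi * exp 1) powr x / 10"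
      using base x by (intro divide_right_mono powr_mono2) auto
    also have "\<dots> = pi powr x * (6 / 10 * x) powr x / ((x / (9 / 10)) powr x * exp (- x) / (1 - 9 / 10))"
    proof -
      have "27 / 50 * pi * exp 1 = pi * (6 / 10 * x) / (x / (9 / 10)) * exp 1"
        using x by simp
      then have "(27 / 50 * pi * exp 1) powr x =
          pi powr x * (6 / 10 * x) powr x / (x / (9 / 10)) powr x * exp x"
        using x by (simp only: powr_mult powr_divide exp_powr_real) simp
      then show ?thesis by (simp add: exp_minus field_simps)
    qed
    also have "\<dots> \<le> pi powr x * (6 / 10 * x) powr x / Gamma (x + 1)"
      using Gamma_plus1_real_upper_bound[of x "9 / 10"] x G
      by (intro divide_left_mono mult_pos_pos) auto
    also have "\<dots> = unit_ball_vol (real d) * sqrt (3 / 10 * real d) ^ d"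
      using sq[of "3 / 10 * real d"] x by (simp add: unit_ball_vol_def x_def)
    finally show ?case .
  qed
qed

section \<open>Volumes of the two balls with arbitrary centre\<close>

lemma Vol_eq: "S \<in> sets (\<Pi>\<^sub>M i\<in>{..<d}. (lborel :: real measure)) \<Longrightarrow>
    Vol d S = measure (\<Pi>\<^sub>M i\<in>{..<d}. (lborel :: real measure)) S"
  by (simp add: Vol_def)

lemma l2_ball_eq: "l2_ball d x e = {y \<in> Rspace d. sqrt (\<Sum>i<d. (y i - x i)\<^sup>2) \<le> e}"
  unfolding l2_ball_def translate_Rspace by (simp add: L2_set_def)

lemma linf_ball_eq_PiE:
  assumes "d \<ge> 1"
  shows "linf_ball d x e = (\<Pi>\<^sub>E i\<in>{..<d}. {x i - e..x i + e})"
proof -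
  have "linf_norm d (\<lambda>i\<in>{..<d}. y i - x i) \<le> e \<longleftrightarrow> (\<forall>i<d. y i \<in> {x i - e..x i + e})" for y
  proof -
    have "linf_norm d (\<lambda>i\<in>{..<d}. y i - x i) \<le> e \<longleftrightarrow> (\<forall>i<d. \<bar>y i - x i\<bar> \<le> e)"
      unfolding linf_norm_def using assms by (subst Max_le_iff) (auto simp: lessThan_empty_iff)
    then show ?thesis by (simp add: abs_diff_le_iff)
  qed
  then show ?thesis
    unfolding linf_ball_def translate_Rspace by (auto simp: Rspace_def PiE_iff extensional_def)
qed

interpretation lborel_PiM: product_sigma_finite "\<lambda>_::nat. lborel :: real measure"
  by standard

lemma Vol_linf_ball:
  assumes "d \<ge> 1" "e \<ge> 0"
  shows "Vol d (linf_ball d x e) = (2 * e) ^ d"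
proof -
  have "emeasure (\<Pi>\<^sub>M i\<in>{..<d}. lborel) (linf_ball d x e) = (\<Prod>i<d. ennreal (2 * e))"
    unfolding linf_ball_eq_PiE[OF assms(1)] using assms(2)
    by (subst lborel_PiM.emeasure_PiM) auto
  then show ?thesis
    using assms by (simp add: Vol_eq linf_ball_sets measure_def ennreal_power)
qed

text \<open>A product measure is determined by its values on boxes, and there the claim is
  translation invariance in each coordinate. It moves the centre of a Euclidean ball to the origin,
  the case covered by \<open>emeasure_cball_aux\<close>.\<close>

lemma distr_PiM_lborel_plus:
  fixes x :: "nat \<Rightarrow> real"
  assumes "finite I"
  shows "distr (\<Pi>\<^sub>M i\<in>I. lborel) (\<Pi>\<^sub>M i\<in>I. lborel) (\<lambda>y. \<lambda>i\<in>I. x i + y i) =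
         (\<Pi>\<^sub>M i\<in>I. (lborel :: real measure))"
proof (rule lborel_PiM.PiM_eqI[OF assms])
  fix A :: "nat \<Rightarrow> real set" assume A: "\<And>i. i \<in> I \<Longrightarrow> A i \<in> sets lborel"
  have "(\<lambda>y. \<lambda>i\<in>I. x i + y i) -` Pi\<^sub>E I A \<inter> space (\<Pi>\<^sub>M i\<in>I. lborel) =
      (\<Pi>\<^sub>E i\<in>I. (+) (x i) -` A i)"
    by (auto simp: space_PiM PiE_iff)
  moreover have "(+) (x i) -` A i \<in> sets lborel" if "i \<in> I" for i
    using measurable_sets[of "(+) (x i)" lborel lborel "A i"] A[OF that] by simp
  moreover have "emeasure lborel ((+) (x i) -` A i) = emeasure lborel (A i)" if "i \<in> I" for i
    using A[OF that] emeasure_distr[of "(+) (x i)" lborel borel "A i"]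
    by (simp add: lborel_distr_plus)
  ultimately show "emeasure (distr (\<Pi>\<^sub>M i\<in>I. lborel) (\<Pi>\<^sub>M i\<in>I. lborel) (\<lambda>y. \<lambda>i\<in>I. x i + y i))
      (Pi\<^sub>E I A) = (\<Prod>i\<in>I. emeasure lborel (A i))"
    using assms A by (subst emeasure_distr) (auto simp: lborel_PiM.emeasure_PiM intro!: sets_PiM_I_finite)
qed simp

lemma Vol_l2_ball:
  assumes "e > 0"
  shows "Vol d (l2_ball d x e) = unit_ball_vol (real d) * e ^ d"
proof -
  let ?M = "\<Pi>\<^sub>M i\<in>{..<d}. (lborel :: real measure)"
  have "emeasure ?M (l2_ball d x e) =
      emeasure (distr ?M ?M (\<lambda>y. \<lambda>i\<in>{..<d}. x i + y i)) (l2_ball d x e)"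
    by (simp add: distr_PiM_lborel_plus)
  also have "\<dots> = emeasure ?M ((\<lambda>y. \<lambda>i\<in>{..<d}. x i + y i) -` l2_ball d x e \<inter> space ?M)"
    by (rule emeasure_distr) (auto simp: l2_ball_sets)
  also have "(\<lambda>y. \<lambda>i\<in>{..<d}. x i + y i) -` l2_ball d x e \<inter> space ?M =
      {f. sqrt (\<Sum>i<d. (f i)\<^sup>2) \<le> e} \<inter> space ?M"
    by (auto simp: l2_ball_eq Rspace_def)
  finally show ?thesis
    using assms emeasure_cball_aux[of "{..<d}" e] by (simp add: Vol_eq l2_ball_sets measure_def)
qed

section \<open>Chernoff bound for the intersection\<close>

text \<open>The quadratic Taylor polynomials of the exponential at \<open>- u\<close> and
  \<open>u\<close> multiply to \<open>1 + u ^ 4 / 4\<close>, which is at least 1, and the one at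
  \<open>u\<close> is at most \<open>exp u\<close>.\<close>

lemma exp_minus_le_quadratic:
  fixes u :: real
  assumes "u \<ge> 0"
  shows "exp (- u) \<le> 1 - u + u\<^sup>2 / 2"
proof -
  have "1 \<le> (1 - u + u\<^sup>2 / 2) * (1 + u + u\<^sup>2 / 2)"
    using assms by (simp add: algebra_simps power2_eq_square)
  also have "\<dots> \<le> (1 - u + u\<^sup>2 / 2) * exp u"
  proof (rule mult_left_mono)
    have "0 \<le> (1 - u)\<^sup>2 + 1" by simp
    then show "0 \<le> 1 - u + u\<^sup>2 / 2" by (simp add: power2_eq_square algebra_simps)
  qed (use assms exp_lower_Taylor_quadratic in auto)
  finally show ?thesis
    by (simp add: exp_minus field_simps)
qed

text \<open>The constant is \<open>(1 - 1 / 15 + 1 / 250) / (1 - 3 / 50)\<close>: the mean over \<open>[-1, 1]\<close> of the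
  quadratic bound in \<open>v\<^sup>2 / 5\<close>, times the estimate \<open>exp t \<le> 1 / (1 - t)\<close> at \<open>t = 3 / 50\<close>.\<close>

lemma nn_integral_exp_square_le:
  fixes a s :: real
  assumes s: "s > 0"
  shows "(\<integral>\<^sup>+y. ennreal (exp (3 / 50 - ((y - a) / s)\<^sup>2 / 5)) * indicator {a - s..a + s} y \<partial>lborel)
    \<le> ennreal (703 / 705 * (2 * s))"
proof -
  define p where "p v = 50 / 47 * (1 - v\<^sup>2 / 5 + (v\<^sup>2 / 5)\<^sup>2 / 2)" for v :: real
  have e: "exp (3 / 50) \<le> (50 / 47 :: real)"
    using exp_ge_add_one_self[of "- (3 / 50)"] by (simp add: exp_minus field_simps)
  have le: "exp (3 / 50 - v\<^sup>2 / 5) \<le> p v" for v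
    unfolding diff_conv_add_uminus exp_add p_def
    using exp_minus_le_quadratic[of "v\<^sup>2 / 5"] by (intro mult_mono e) auto
  have p0: "p v \<ge> 0" for v using le[of v] exp_ge_zero[of "3 / 50 - v\<^sup>2 / 5"] by linarith
  \<comment> \<open>\<open>P\<close> is the odd primitive of \<open>p\<close>, so the integral below
    is \<open>2 * s * P 1\<close>, and \<open>P 1 = 703 / 705\<close>.\<close>
  define P where "P v = 50 / 47 * (v - v ^ 3 / 15 + v ^ 5 / 250)" for v :: real
  have D: "((\<lambda>y. s * P ((y - a) / s)) has_real_derivative p ((y - a) / s)) (at y)" for y
    unfolding P_def p_def using s
    by (auto intro!: derivative_eq_intros simp: field_simps power2_eq_square eval_nat_numeral)
  have "(\<integral>\<^sup>+y. ennreal (exp (3 / 50 - ((y - a) / s)\<^sup>2 / 5)) * indicator {a - s..a + s} y \<partial>lborel)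
      \<le> (\<integral>\<^sup>+y. ennreal (p ((y - a) / s)) * indicator {a - s..a + s} y \<partial>lborel)"
    by (intro nn_integral_mono mult_right_mono ennreal_leI le) auto
  also have "\<dots> = ennreal (s * P ((a + s - a) / s) - s * P ((a - s - a) / s))"
    using s p0 D
    by (intro nn_integral_FTC_Icc) (auto simp: p_def has_real_derivative_iff_has_vector_derivative)
  also have "\<dots> \<le> ennreal (703 / 705 * (2 * s))"
    using s by (simp add: P_def)
  finally show ?thesis .
qed

text \<open>Chernoff's bound: with \<open>v\<^sub>i = (y\<^sub>i - x\<^sub>i) / s\<close> the product of the factors
  \<open>exp (3 / 50 - v\<^sub>i\<^sup>2 / 5)\<close> is at least 1 on the Euclidean ball.\<close>

lemma Vol_inter_le:
  assumes d: "d \<ge> 1" and s: "s > 0" and r: "r\<^sup>2 \<le> 3 / 10 * real d * s\<^sup>2"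
  shows "Vol d (l2_ball d x r \<inter> linf_ball d x s) \<le> (703 / 705) ^ d * (2 * s) ^ d"
proof -
  let ?M = "\<Pi>\<^sub>M i\<in>{..<d}. (lborel :: real measure)"
  let ?f = "\<lambda>i y. ennreal (exp (3 / 50 - ((y - x i) / s)\<^sup>2 / 5)) * indicator {x i - s..x i + s} y"
  have sets: "l2_ball d x r \<inter> linf_ball d x s \<in> sets ?M"
    using l2_ball_sets linf_ball_sets[OF d] by (rule sets.Int)
  have "indicator (l2_ball d x r \<inter> linf_ball d x s) y \<le> (\<Prod>i<d. ?f i (y i))" for y
  proof (cases "y \<in> l2_ball d x r \<inter> linf_ball d x s")
    case True
    then have "sqrt (\<Sum>i<d. (y i - x i)\<^sup>2) \<le> r"
      by (simp add: l2_ball_eq)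
    then have "(\<Sum>i<d. (y i - x i)\<^sup>2) \<le> r\<^sup>2"
      by (rule sqrt_le_D)
    also note r
    finally have "(\<Sum>i<d. (y i - x i)\<^sup>2) / s\<^sup>2 \<le> 3 / 10 * real d"
      using s by (simp add: field_simps)
    then have "(\<Sum>i<d. ((y i - x i) / s)\<^sup>2) \<le> 3 / 10 * real d"
      by (simp add: power_divide sum_divide_distrib)
    \<comment> \<open>The constant \<open>3 / 50\<close> is \<open>3 / 10\<close> divided by 5, so
      the bound on the mean of the squares makes the exponents sum to something nonnegative.\<close>
    then have "0 \<le> (\<Sum>i<d. 3 / 50 - ((y i - x i) / s)\<^sup>2 / 5)"
      by (simp add: sum_subtractf flip: sum_divide_distrib)
    then have "1 \<le> (\<Prod>i<d. exp (3 / 50 - ((y i - x i) / s)\<^sup>2 / 5))"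
      by (simp flip: exp_sum)
    then have "1 \<le> ennreal (\<Prod>i<d. exp (3 / 50 - ((y i - x i) / s)\<^sup>2 / 5))"
      by simp
    also have "\<dots> = (\<Prod>i<d. ennreal (exp (3 / 50 - ((y i - x i) / s)\<^sup>2 / 5)))"
      by (simp add: prod_ennreal)
    also have "\<dots> = (\<Prod>i<d. ?f i (y i))"
      using True d by (intro prod.cong) (auto simp: linf_ball_eq_PiE PiE_iff)
    finally show ?thesis using True by simp
  qed simp
  then have "emeasure ?M (l2_ball d x r \<inter> linf_ball d x s) \<le> (\<integral>\<^sup>+y. (\<Prod>i<d. ?f i (y i)) \<partial>?M)"
    using sets by (simp flip: nn_integral_indicator add: nn_integral_mono)
  also have "\<dots> = (\<Prod>i<d. \<integral>\<^sup>+y. ?f i y \<partial>lborel)"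
    by (rule lborel_PiM.product_nn_integral_prod) auto
  also have "\<dots> \<le> (\<Prod>i<d. ennreal (703 / 705 * (2 * s)))"
    using s by (intro prod_mono_ennreal nn_integral_exp_square_le)
  also have "\<dots> = ennreal ((703 / 705) ^ d * (2 * s) ^ d)"
    using s by (subst power_mult_distrib[symmetric]) (simp add: ennreal_power)
  finally show ?thesis
    using s unfolding Vol_eq[OF sets] measure_def by (intro enn2real_leI) auto
qed

theorem theorem1:
  fixes c :: "nat \<Rightarrow> nat \<Rightarrow> real" and r s :: "nat \<Rightarrow> real"
  assumes "\<And>d. d \<ge> 1 \<Longrightarrow> c d \<in> Rspace d"
    and "\<And>d. d \<ge> 1 \<Longrightarrow> r d > 0"
    and "\<And>d. d \<ge> 1 \<Longrightarrow> s d > 0"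
    and "\<And>d. d \<ge> 1 \<Longrightarrow> Vol d (l2_ball d (c d) (r d)) = Vol d (linf_ball d (c d) (s d))"
  shows "(\<lambda>d. Vol d (l2_ball d (c d) (r d) \<inter> linf_ball d (c d) (s d)) /
              Vol d (linf_ball d (c d) (s d))) \<longlonglongrightarrow> 0"
proof (rule tendsto_sandwich)
  show "\<forall>\<^sub>F d in sequentially. 0 \<le> Vol d (l2_ball d (c d) (r d) \<inter> linf_ball d (c d) (s d)) /
              Vol d (linf_ball d (c d) (s d))"
    by (simp add: Vol_def)
  show "\<forall>\<^sub>F d in sequentially. Vol d (l2_ball d (c d) (r d) \<inter> linf_ball d (c d) (s d)) /
              Vol d (linf_ball d (c d) (s d)) \<le> (703 / 705) ^ d"
    using eventually_unit_ball_vol_gt eventually_ge_at_top[of 1]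
  proof eventually_elim
    case (elim d)
    note d = \<open>d \<ge> 1\<close>
    have rs: "r d > 0" "s d > 0" using assms(2,3)[OF d] .
    have V: "unit_ball_vol (real d) * r d ^ d = 2 ^ d * s d ^ d"
      using assms(4)[OF d] rs d by (simp add: Vol_l2_ball Vol_linf_ball power_mult_distrib)
    have "r d \<le> sqrt (3 / 10 * real d) * s d"
    \<comment> \<open>A larger \<open>r d\<close> would, by
      \<open>eventually_unit_ball_vol_gt\<close>, give the Euclidean ball strictly more volume than
      the cube, against \<open>V\<close>.\<close>
    proof (rule ccontr)
      assume "\<not> ?thesis"
      then have "unit_ball_vol (real d) * (sqrt (3 / 10 * real d) * s d) ^ d
          \<le> unit_ball_vol (real d) * r d ^ d"
        using rs by (intro mult_left_mono power_mono) auto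
      with V have "(unit_ball_vol (real d) * sqrt (3 / 10 * real d) ^ d) * s d ^ d \<le> 2 ^ d * s d ^ d"
        by (simp add: power_mult_distrib)
      with rs elim(1) show False by simp
    qed
    then have "(r d)\<^sup>2 \<le> (sqrt (3 / 10 * real d) * s d)\<^sup>2"
      using rs by (intro power_mono) auto
    then have "(r d)\<^sup>2 \<le> 3 / 10 * real d * (s d)\<^sup>2"
      by (simp add: power_mult_distrib)
    from Vol_inter_le[OF d rs(2) this, of "c d"] show ?case
      using rs d by (simp add: Vol_linf_ball field_simps)
  qed
  show "(\<lambda>d. (703 / 705 :: real) ^ d) \<longlonglongrightarrow> 0"
    by (rule LIMSEQ_power_zero) simp
qed simp

end
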